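(* Let $A\in\mathbb{R}^{n\times n}$ be a symmetric matrix with $(i,j)$ entry $a_{ij}$, whose diagonal entries satisfy $a_{11}\geq a_{22}\geq\dotsb\geq a_{nn}$. Let $\epsilon$ be a real number and suppose that for all $i\neq j$, $$L_{ij}(A)=\frac{2|a_{ij}|^{2}}{|a_{ii}-a_{jj}|+\sqrt{|a_{ii}-a_{jj}|^{2}+4|a_{ij}|^{2}}}\leq \epsilon.$$ Let $\lambda_k(A)$ denote the $k$-th largest eigenvalue of $A$. Then for every $k=1,\dotsc,n$, $$\bigl|\lambda_{k}(A)-a_{kk}\bigr|\leq 2n(n-1)\epsilon.$$
   Context: Eigenvalues of a real symmetric $n\times n$ matrix are counted with multiplicity and ordered as $\lambda_1(A)\geq\lambda_2(A)\geq\dotsb\geq\lambda_n(A)$. The quantity $L_{ij}(A)$ is understood to be $0$ when its numerator and denominator both vanish, i.e. when $a_{ij}=0$ and $a_{ii}=a_{jj}$. *)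

theory Defs
  imports Complex_Main "Jordan_Normal_Form.Char_Poly"
begin

definition symmetric_mat :: "real mat \<Rightarrow> bool" where
  "symmetric_mat A \<longleftrightarrow> square_mat A \<and> transpose_mat A = A"

text \<open>Multiplicity is algebraic multiplicity; for real symmetric matrices it agrees with the
  geometric one.\<close>

definition eigenvalue_mset :: "real mat \<Rightarrow> real multiset" where
  "eigenvalue_mset A = proots (char_poly A)"

lemma set_mset_eigenvalue_mset:
  assumes "A \<in> carrier_mat n n"
  shows "set_mset (eigenvalue_mset A) = {x. eigenvalue A x}"
proof -
  have "char_poly A \<noteq> 0"
    using degree_monic_char_poly[OF assms] by auto
  then show ?thesis
    by (simp add: eigenvalue_mset_def eigenvalue_root_char_poly[OF assms])
qed

text \<open>Indices of matrices start at 0, and so does the numbering of the eigenvalues: for a symmetric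
  matrix of size n the values at 0, ..., n - 1 are the eigenvalues from the largest to the
  smallest.\<close>

definition ordered_eigenvalue :: "real mat \<Rightarrow> nat \<Rightarrow> real" where
  "ordered_eigenvalue A k = rev (sorted_list_of_multiset (eigenvalue_mset A)) ! k"

text \<open>The denominator vanishes only if the off-diagonal entry is 0 and the two diagonal entries
  coincide. The value is then 0, by division by zero, as intended.\<close>

definition L_entry :: "real mat \<Rightarrow> nat \<Rightarrow> nat \<Rightarrow> real" where
  "L_entry A i j =
     2 * \<bar>A $$ (i, j)\<bar>\<^sup>2 /
     (\<bar>A $$ (i, i) - A $$ (j, j)\<bar> +
      sqrt (\<bar>A $$ (i, i) - A $$ (j, j)\<bar>\<^sup>2 + 4 * \<bar>A $$ (i, j)\<bar>\<^sup>2))"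

end

theory Submission
  imports Defs "Jordan_Normal_Form.Schur_Decomposition"
begin

text \<open>
  The quantity \<open>L_entry A i j\<close> equals
  \<open>(sqrt (\<delta>\<^sup>2 + 4 a\<^sup>2) - \<delta>) / 2\<close> with \<open>a\<close> the off-diagonal entry and \<open>\<delta>\<close> the gap between the
  two diagonal entries: it is the nonnegative root of \<open>t\<^sup>2 + \<delta> t - a\<^sup>2\<close>. So, for \<open>\<epsilon> \<ge> 0\<close>,
  the bound by \<open>\<epsilon>\<close> says exactly \<open>a\<^sup>2 \<le> \<epsilon> (\<epsilon> + \<delta>)\<close> (\<open>L_entry_le_iff\<close>): an entry may be much
  larger than \<open>\<epsilon>\<close>, but only if it joins two diagonal entries that are far apart.

  To bound the eigenvalue number \<open>k\<close> from below, let \<open>c\<close> be the \<open>k\<close>-th diagonal entry minus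
  \<open>n\<^sup>2 \<epsilon>\<close>, and look at the leading principal submatrix with last index \<open>k\<close>. Its diagonal entries
  exceed \<open>c\<close> by amounts \<open>d\<^sub>i \<ge> n\<^sup>2 \<epsilon>\<close>, because the diagonal is decreasing, and the gap between
  two of them is at most \<open>d\<^sub>i + d\<^sub>j - 2 n\<^sup>2 \<epsilon>\<close>. Hence a large off-diagonal entry comes with a large
  \<open>d\<^sub>i d\<^sub>j\<close>: the bound on \<open>a\<^sup>2\<close> gives \<open>(n a\<^sub>i\<^sub>j)\<^sup>2 \<le> d\<^sub>i d\<^sub>j\<close>. After rescaling the coordinates
  by \<open>sqrt d\<^sub>i\<close> this is diagonal dominance, so the submatrix minus \<open>c\<close> times the identity is
  positive semidefinite (\<open>weighted_diagonal_dominance\<close>, \<open>form_ge_on_coordinate_subspace\<close>).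
  The quadratic form of \<open>A\<close> is thus at least \<open>c\<close> times the squared norm on a coordinate subspace of
  dimension \<open>k + 1\<close> (indices start at 0), and the easy half of the Courant-Fischer principle makes
  eigenvalue number \<open>k\<close> at least \<open>c\<close> (\<open>eigenvalue_ge_of_form_ge\<close>).

  The upper bound is the same argument for \<open>-A\<close> and the trailing principal submatrix that starts at
  \<open>k\<close>. Together they bound the error by \<open>n\<^sup>2 \<epsilon>\<close>
  (\<open>ordered_eigenvalue_near_diagonal\<close>), and \<open>n\<^sup>2 \<le> 2 n (n - 1)\<close> as soon as
  \<open>n \<ge> 2\<close>. Courant-Fischer rests on an orthonormal eigenbasis
  (\<open>symmetric_orthogonally_diagonalizable\<close>), whose eigenvalues can be listed in any prescribed order
  and counted by algebraic multiplicity.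
\<close>

section \<open>Real eigenvalues of symmetric matrices\<close>

text \<open>For an eigenvector \<open>v\<close> the conjugate \<open>w\<close> is an eigenvector for the conjugate eigenvalue, as
  \<open>A\<close> is real. Moving the symmetric matrix across the bilinear product of \<open>v\<close> and \<open>w\<close>
  shows that the two eigenvalues agree, since that product is the squared norm of \<open>v\<close>.\<close>

lemma symmetric_eigenvalue_real:
  fixes A :: "real mat"
  assumes A: "A \<in> carrier_mat n n" and sym: "transpose_mat A = A"
    and z: "eigenvalue (map_mat complex_of_real A) z"
  shows "z \<in> \<real>"
proof -
  define B where "B = map_mat complex_of_real A"
  have B: "B \<in> carrier_mat n n" using A by (simp add: B_def)
  have symB: "transpose_mat B = B"
    unfolding B_def by (subst (2) sym[symmetric], rule eq_matI) auto
  obtain v where v: "v \<in> carrier_vec n" "v \<noteq> 0\<^sub>v n" "B *\<^sub>v v = z \<cdot>\<^sub>v v"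
    using z B unfolding B_def[symmetric] eigenvalue_def eigenvector_def by auto
  define w where "w = conjugate v"
  have w: "w \<in> carrier_vec n" using v by (simp add: w_def)
  have "B *\<^sub>v w = conjugate (B *\<^sub>v v)"
    using A v(1) by (intro eq_vecI) (auto simp: B_def w_def scalar_prod_def)
  also have "\<dots> = cnj z \<cdot>\<^sub>v w"
    unfolding v(3) w_def using v(1) by (intro eq_vecI) auto
  finally have Bw: "B *\<^sub>v w = cnj z \<cdot>\<^sub>v w" .
  have "z * (v \<bullet> w) = (transpose_mat B *\<^sub>v v) \<bullet> w"
    unfolding symB v(3) using v(1) w by simp
  also have "\<dots> = v \<bullet> (B *\<^sub>v w)"
    using transpose_vec_mult_scalar[OF B w v(1)] .
  also have "\<dots> = cnj z * (v \<bullet> w)"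
    unfolding Bw using v(1) w by simp
  finally have "z = cnj z"
    using v(1,2) conjugate_square_eq_0_vec[OF v(1)] by (auto simp: w_def)
  then show ?thesis
    by (simp add: complex_is_Real_iff complex_eq_iff)
qed

text \<open>The complex factorization has only real roots, and mapping real polynomials to complex ones is
  injective.\<close>

lemma char_poly_symmetric_factorized:
  fixes A :: "real mat"
  assumes A: "A \<in> carrier_mat n n" and sym: "transpose_mat A = A"
  obtains es where "char_poly A = (\<Prod>e\<leftarrow>es. [:- e, 1:])"
proof -
  interpret of_real_poly: map_poly_inj_idom_hom complex_of_real ..
  define B where "B = map_mat complex_of_real A"
  have B: "B \<in> carrier_mat n n" using A by (simp add: B_def)
  obtain zs where zs: "char_poly B = (\<Prod>z\<leftarrow>zs. [:- z, 1:])"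
    using char_poly_factorized[OF B] by blast
  have "z \<in> \<real>" if "z \<in> set zs" for z
  proof -
    have "poly (char_poly B) z = 0"
      using that unfolding zs poly_prod_list by (auto simp: prod_list_zero_iff)
    then show ?thesis
      using symmetric_eigenvalue_real[OF A sym] eigenvalue_root_char_poly[OF B]
      by (simp add: B_def)
  qed
  then have zs_Re: "zs = map complex_of_real (map Re zs)"
    by (auto intro!: map_idI[symmetric] simp: comp_def)
  have "map_poly complex_of_real (char_poly A) = char_poly B"
    unfolding B_def of_real_hom.char_poly_hom[OF A] ..
  also have "\<dots> = map_poly complex_of_real (\<Prod>e\<leftarrow>map Re zs. [:- e, 1:])"
    unfolding zs by (subst zs_Re) (simp add: of_real_poly.hom_prod_list comp_def)
  finally have "char_poly A = (\<Prod>e\<leftarrow>map Re zs. [:- e, 1:])"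
    by simp
  then show ?thesis by (rule that)
qed

text \<open>This is the link between the numbering by \<^const>\<open>ordered_eigenvalue\<close> and the diagonal of a
  diagonalization: the multiset of roots is complete, so it lists the linear factors.\<close>

lemma ordered_eigenvalues_factorize_char_poly:
  fixes A :: "real mat"
  assumes A: "A \<in> carrier_mat n n" and sym: "transpose_mat A = A"
  defines "es \<equiv> rev (sorted_list_of_multiset (eigenvalue_mset A))"
  shows "char_poly A = (\<Prod>e\<leftarrow>es. [:- e, 1:])" and "length es = n"
    and "\<And>i j. i \<le> j \<Longrightarrow> j < n \<Longrightarrow> es ! j \<le> es ! i"
proof -
  obtain fs where fs: "char_poly A = (\<Prod>e\<leftarrow>fs. [:- e, 1:])"
    using char_poly_symmetric_factorized[OF A sym] .
  have "proots (\<Prod>e\<leftarrow>fs. [:- e, 1:]) = mset fs"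
    by (induction fs) (simp_all add: proots_mult prod_list_zero_iff image_iff del: mult_pCons_left)
  then have "mset es = mset fs" by (simp add: es_def eigenvalue_mset_def fs)
  then have "mset (map (\<lambda>e. [:- e, 1:]) es) = mset (map (\<lambda>e. [:- e, 1:]) fs)"
    by simp
  then show cp: "char_poly A = (\<Prod>e\<leftarrow>es. [:- e, 1:])"
    unfolding fs by (metis prod_mset_prod_list)
  show len: "length es = n"
    using degree_linear_factors[of uminus es] degree_monic_char_poly[OF A] by (simp add: cp)
  have "sorted (rev es)" by (simp add: es_def)
  then show "es ! j \<le> es ! i" if "i \<le> j" "j < n" for i j
    using that len by (simp add: sorted_rev_nth_mono)
qed

section \<open>Orthogonal diagonalization\<close>

text \<open>Gram-Schmidt on a basis that starts with \<open>v\<close> keeps \<open>v\<close> as first vector; the vectors still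
  have to be normalized, so that the transpose becomes the inverse.\<close>

lemma orthogonal_mat_extending_vec:
  fixes v :: "real vec"
  assumes v: "v \<in> carrier_vec n" and v0: "v \<noteq> 0\<^sub>v n"
  obtains W c where "W \<in> carrier_mat n n" "transpose_mat W * W = 1\<^sub>m n" "col W 0 = c \<cdot>\<^sub>v v"
proof -
  interpret cof_vec_space n "TYPE(real)" .
  define b where "b = basis_completion v"
  define ws where "ws = gram_schmidt n b"
  note b = basis_completion[OF v v0, folded b_def]
  have n: "n \<noteq> 0" using v v0 by (auto intro!: eq_vecI)
  obtain vs where bv: "b = v # vs"
    using b(6,7) n by (cases b) auto
  have ws: "set ws \<subseteq> carrier_vec n" "corthogonal ws" "length ws = n"
    using gram_schmidt_result[OF b(2,4,5) ws_def] b(6) by auto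
  have hd_ws: "ws ! 0 = v"
    using gram_schmidt_hd[OF v, of vs, folded bv ws_def] ws(3) n by (cases ws) auto
  have wsi: "ws ! i \<in> carrier_vec n" if "i < n" for i
    using ws that by auto
  have conj: "conjugate w = w" for w :: "real vec"
    by (intro eq_vecI) auto
  define u where "u i = (1 / sqrt (ws ! i \<bullet> ws ! i)) \<cdot>\<^sub>v ws ! i" for i
  have u: "u i \<in> carrier_vec n" if "i < n" for i
    using wsi[OF that] by (simp add: u_def)
  have orth: "u i \<bullet> u j = (if i = j then 1 else 0)" if "i < n" "j < n" for i j
  proof (cases "i = j")
    case True
    have "ws ! i \<bullet> ws ! i \<noteq> 0"
      using corthogonalD[OF ws(2), of i i] that ws(3) conj by simp
    moreover have "ws ! i \<bullet> ws ! i \<ge> 0"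
      using conjugate_square_ge_0_vec[of "ws ! i"] conj by simp
    ultimately show ?thesis
      using True wsi[OF that(1)] by (simp add: u_def)
  next
    case False
    then have "ws ! i \<bullet> ws ! j = 0"
      using corthogonalD[OF ws(2), of i j] that ws(3) conj by simp
    then show ?thesis
      using False wsi[OF that(1)] wsi[OF that(2)] by (simp add: u_def)
  qed
  define W where "W = mat_of_cols n (map u [0..<n])"
  have W: "W \<in> carrier_mat n n"
    by (simp add: W_def carrier_matI)
  have col_W: "col W i = u i" if "i < n" for i
    using that u by (simp add: W_def)
  have "transpose_mat W * W = 1\<^sub>m n"
    using W by (intro eq_matI) (auto simp: col_W orth)
  moreover have "col W 0 = (1 / sqrt (v \<bullet> v)) \<cdot>\<^sub>v v"
    using n by (simp add: col_W u_def hd_ws)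
  ultimately show ?thesis using W that by blast
qed

text \<open>Deflation. In an orthonormal basis that starts with an eigenvector for the first root, the
  first column of the transformed matrix is a multiple of the first unit vector. Symmetry survives the
  orthogonal change of basis and clears the first row too, so the matrix splits into a block of size 1
  and a smaller symmetric matrix with the remaining roots. As each step may split off any root, the
  roots appear on the diagonal in the order of the given list.\<close>

theorem symmetric_orthogonally_diagonalizable:
  fixes A :: "real mat"
  assumes "A \<in> carrier_mat n n" and "transpose_mat A = A"
    and "char_poly A = (\<Prod>e\<leftarrow>es. [:- e, 1:])"
  shows "\<exists>Q \<in> carrier_mat n n. transpose_mat Q * Q = 1\<^sub>m n \<and>
           transpose_mat Q * A * Q = mat_diag n (\<lambda>i. es ! i)"
  using assms
proof (induction es arbitrary: n A)
  case Nil
  then have "n = 0"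
    using degree_monic_char_poly[of A n] by simp
  then show ?case
    using Nil by (intro bexI[of _ "1\<^sub>m 0"]) (auto intro!: eq_matI simp: mat_diag_def)
next
  case (Cons e es)
  note A = Cons.prems(1) and sym = Cons.prems(2)
  have "length (e # es) = n"
    using degree_linear_factors[of uminus "e # es"] degree_monic_char_poly[OF A] Cons.prems(3)
    by simp
  then obtain m where n: "n = Suc m" by auto
  have "eigenvalue A e"
    unfolding eigenvalue_root_char_poly[OF A] Cons.prems(3) by simp
  then obtain v where v: "v \<in> carrier_vec n" "v \<noteq> 0\<^sub>v n" "A *\<^sub>v v = e \<cdot>\<^sub>v v"
    using A unfolding eigenvalue_def eigenvector_def by auto
  obtain W c where W: "W \<in> carrier_mat n n" and WW: "transpose_mat W * W = 1\<^sub>m n"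
    and col_W: "col W 0 = c \<cdot>\<^sub>v v"
    using orthogonal_mat_extending_vec[OF v(1,2)] .
  define A' where "A' = transpose_mat W * A * W"
  have A': "A' \<in> carrier_mat n n"
    using W A by (simp add: A'_def)
  have symA': "transpose_mat A' = A'"
  proof -
    have "transpose_mat A' = transpose_mat W * transpose_mat (transpose_mat W * A)"
      unfolding A'_def using W A by (subst transpose_mult[of _ n n _ n]) auto
    also have "transpose_mat (transpose_mat W * A) = A * W"
      using W A sym by (subst transpose_mult[of _ n n _ n]) auto
    also have "transpose_mat W * (A * W) = A'"
      unfolding A'_def using W A by (subst assoc_mult_mat[of _ n n _ n _ n]) auto
    finally show ?thesis .
  qed
  have col_A': "A' $$ (i, 0) = (if i = 0 then e else 0)" if i: "i < n" for i
  proof -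
    have "A *\<^sub>v col W 0 = e \<cdot>\<^sub>v col W 0"
      unfolding col_W using v A by (simp add: mult_mat_vec smult_smult_assoc mult.commute)
    then have "col (A * W) 0 = e \<cdot>\<^sub>v col W 0"
      using col_mult2[OF A W, of 0] n by simp
    moreover have "A' = transpose_mat W * (A * W)"
      unfolding A'_def using W A by (subst assoc_mult_mat[of _ n n _ n _ n]) auto
    ultimately have "A' $$ (i, 0) = e * (col W i \<bullet> col W 0)"
      using W A i n by simp
    also have "col W i \<bullet> col W 0 = (transpose_mat W * W) $$ (i, 0)"
      using W i n by simp
    finally show ?thesis
      using i n by (simp add: WW)
  qed
  have row_A': "A' $$ (0, j) = (if j = 0 then e else 0)" if j: "j < n" for j
    using col_A'[OF j] A' j n by (subst symA'[symmetric]) auto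
  define A1 where "A1 = mat 1 1 (\<lambda>_. e)"
  define A3 where "A3 = mat m m (\<lambda>(i, j). A' $$ (Suc i, Suc j))"
  have A1: "A1 \<in> carrier_mat 1 1" and A3: "A3 \<in> carrier_mat m m"
    by (simp_all add: A1_def A3_def)
  have block: "A' = four_block_mat A1 (0\<^sub>m 1 m) (0\<^sub>m m 1) A3"
    using A' n col_A' row_A' by (intro eq_matI) (auto simp: A1_def A3_def)
  have symA3: "transpose_mat A3 = A3"
  proof (rule eq_matI)
    fix i j assume "i < dim_row A3" "j < dim_col A3"
    then have ij: "i < m" "j < m" by (auto simp: A3_def)
    then have "A' $$ (Suc j, Suc i) = transpose_mat A' $$ (Suc i, Suc j)"
      using A' n by simp
    then show "transpose_mat A3 $$ (i, j) = A3 $$ (i, j)"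
      using ij by (simp add: A3_def symA')
  qed (auto simp: A3_def)
  have WW': "W * transpose_mat W = 1\<^sub>m n"
    using mat_mult_left_right_inverse[OF _ W WW] W by simp
  have "similar_mat_wit A' A (transpose_mat W) W"
    using W A A' WW WW' by (intro similar_mat_witI[of _ _ n]) (auto simp: A'_def)
  then have "char_poly A' = [:- e, 1:] * (\<Prod>e\<leftarrow>es. [:- e, 1:])"
    using char_poly_similar[of A' A] Cons.prems(3) unfolding similar_mat_def by auto
  moreover have "char_poly A' = char_poly A1 * char_poly A3"
    unfolding block by (rule char_poly_four_block_zeros_col[OF A1 _ A3]) simp
  moreover have "char_poly A1 = [:- e, 1:]"
    by (simp add: A1_def char_poly_defs det_def sign_def)
  ultimately have "char_poly A3 = (\<Prod>e\<leftarrow>es. [:- e, 1:])"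
    by (metis mult_cancel_left pCons_eq_0_iff zero_neq_one)
  from Cons.IH[OF A3 symA3 this] obtain P where P: "P \<in> carrier_mat m m"
    and PP: "transpose_mat P * P = 1\<^sub>m m"
    and PAP: "transpose_mat P * A3 * P = mat_diag m (\<lambda>i. es ! i)" by blast
  define F where "F = four_block_mat (1\<^sub>m 1) (0\<^sub>m 1 m) (0\<^sub>m m 1) P"
  have F: "F \<in> carrier_mat n n"
    using four_block_carrier_mat[of "1\<^sub>m 1" 1 1 P m m] P n by (simp add: F_def)
  have tF: "transpose_mat F = four_block_mat (1\<^sub>m 1) (0\<^sub>m 1 m) (0\<^sub>m m 1) (transpose_mat P)"
    unfolding F_def using P by (subst transpose_four_block_mat) auto
  have FF: "transpose_mat F * F = 1\<^sub>m n"
    unfolding tF unfolding F_def using P PP n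
    by (subst mult_four_block_mat[of _ 1 1 _ m _ m]) auto
  have FAF: "transpose_mat F * A' * F = mat_diag n (\<lambda>i. (e # es) ! i)"
  proof -
    have "transpose_mat F * A' = four_block_mat A1 (0\<^sub>m 1 m) (0\<^sub>m m 1) (transpose_mat P * A3)"
      unfolding tF block using P A1 A3
      by (subst mult_four_block_mat[of _ 1 1 _ m _ m]) auto
    also have "\<dots> * F = four_block_mat A1 (0\<^sub>m 1 m) (0\<^sub>m m 1) (transpose_mat P * A3 * P)"
      unfolding F_def using P A1 A3
      by (subst mult_four_block_mat[of _ 1 1 _ m _ m]) auto
    finally show ?thesis
      unfolding PAP using n
      by (intro eq_matI) (auto simp: A1_def mat_diag_def nth_Cons')
  qed
  define Q where "Q = W * F"
  have Q: "Q \<in> carrier_mat n n"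
    using W F by (simp add: Q_def)
  have tQ: "transpose_mat Q = transpose_mat F * transpose_mat W"
    unfolding Q_def using W F by (subst transpose_mult[of _ n n _ n]) auto
  have conj: "transpose_mat Q * M * Q = transpose_mat F * (transpose_mat W * M * W) * F"
    if "M \<in> carrier_mat n n" for M
    unfolding tQ unfolding Q_def using that W F
    by (simp add: assoc_mult_mat[of _ n n _ n _ n])
  have "transpose_mat Q * Q = 1\<^sub>m n"
    using conj[of "1\<^sub>m n"] W F Q WW FF by simp
  moreover have "transpose_mat Q * A * Q = mat_diag n (\<lambda>i. (e # es) ! i)"
    unfolding conj[OF A] A'_def[symmetric] FAF ..
  ultimately show ?case using Q by blast
qed

section \<open>Half of the Courant-Fischer principle\<close>

text \<open>At most \<open>n - 1\<close> homogeneous linear equations in \<open>n\<close> unknowns have a nonzero solution. The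
  equations are the rows of a square matrix in which row \<open>k\<close> stays zero, so that its determinant
  vanishes.\<close>

lemma exists_vec_with_vanishing_coordinates:
  fixes P :: "real mat"
  assumes P: "P \<in> carrier_mat n n" and k: "k < n" "k \<notin> S" "k \<notin> T" and ST: "S \<inter> T = {}"
    and sub: "S \<subseteq> {..<n}" "T \<subseteq> {..<n}"
  obtains x where "x \<in> carrier_vec n" "x \<noteq> 0\<^sub>v n"
    "\<And>r. r \<in> S \<Longrightarrow> x $ r = 0" "\<And>r. r \<in> T \<Longrightarrow> (P *\<^sub>v x) $ r = 0"
proof -
  define R where "R r = (if r \<in> S then unit_vec n r else if r \<in> T then row P r else 0\<^sub>v n)" for r
  define M where "M = mat_of_rows n (map R [0..<n])"
  have M: "M \<in> carrier_mat n n" by (simp add: M_def carrier_matI)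
  have R: "R r \<in> carrier_vec n" for r
    using P by (auto simp: R_def)
  have row_M: "row M r = R r" if "r < n" for r
    using that R by (simp add: M_def)
  have "det M = 0"
  proof -
    have "det (transpose_mat M) = 0"
    proof -
      have "unit_vec n k \<in> (carrier_vec n :: real vec set)" "unit_vec n k \<noteq> (0\<^sub>v n :: real vec)"
        using k by auto
      moreover have "transpose_mat M *\<^sub>v unit_vec n k = 0\<^sub>v n"
        using M k row_M[OF k(1)]
        by (intro eq_vecI) (auto simp: R_def row_def vec_eq_iff)
      ultimately show ?thesis
        using det_0_iff_vec_prod_zero_field[of "transpose_mat M" n] M by (metis transpose_carrier_mat)
    qed
    then show ?thesis using det_transpose[OF M] by simp
  qed
  then obtain x where x: "x \<in> carrier_vec n" "x \<noteq> 0\<^sub>v n" "M *\<^sub>v x = 0\<^sub>v n"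
    using det_0_iff_vec_prod_zero_field[OF M] by blast
  have Rx: "R r \<bullet> x = 0" if "r < n" for r
  proof -
    have "(M *\<^sub>v x) $ r = 0" using x that by simp
    then show ?thesis using M that row_M by simp
  qed
  have "x $ r = 0" if "r \<in> S" for r
    using Rx[of r] that sub x by (auto simp: R_def)
  moreover have "(P *\<^sub>v x) $ r = 0" if "r \<in> T" for r
  proof -
    have "r < n" "r \<notin> S" using that sub ST by auto
    then show ?thesis using Rx[of r] that P by (simp add: R_def)
  qed
  ultimately show ?thesis using that x by blast
qed

text \<open>If the conclusion failed, take a nonzero \<open>x\<close> in the coordinate subspace that is orthogonal to
  the eigenvectors with index in \<open>T\<close>. In the eigenbasis, the form at \<open>x\<close> is then a combination of
  squares with coefficients below \<open>c\<close> only, against the hypothesis on the subspace.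
  Leaving \<open>S\<close> and \<open>T\<close> free serves the lower bounds for the matrix and for its negative, where the
  eigenvalues are listed in increasing order.\<close>

lemma eigenvalue_ge_of_form_ge:
  fixes A :: "real mat"
  assumes A: "A \<in> carrier_mat n n" and Q: "Q \<in> carrier_mat n n"
    and QQ: "transpose_mat Q * Q = 1\<^sub>m n"
    and diag: "transpose_mat Q * A * Q = mat_diag n f"
    and k: "k < n" "k \<notin> S" "k \<notin> T"
    and part: "S \<inter> T = {}" "S \<subseteq> {..<n}" "T \<subseteq> {..<n}"
    and form: "\<And>x. x \<in> carrier_vec n \<Longrightarrow> (\<And>r. r \<in> S \<Longrightarrow> x $ r = 0) \<Longrightarrow>
                  c * (x \<bullet> x) \<le> x \<bullet> (A *\<^sub>v x)"
  shows "\<exists>j<n. j \<notin> T \<and> c \<le> f j"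
proof (rule ccontr)
  assume "\<not> ?thesis"
  then have less: "f j < c" if "j < n" "j \<notin> T" for j
    using that by force
  have tQ: "transpose_mat Q \<in> carrier_mat n n" using Q by simp
  have QQ': "Q * transpose_mat Q = 1\<^sub>m n"
    using mat_mult_left_right_inverse[OF tQ Q QQ] .
  obtain x where x: "x \<in> carrier_vec n" "x \<noteq> 0\<^sub>v n" "\<And>r. r \<in> S \<Longrightarrow> x $ r = 0"
    "\<And>r. r \<in> T \<Longrightarrow> (transpose_mat Q *\<^sub>v x) $ r = 0"
    using exists_vec_with_vanishing_coordinates[OF tQ k part] by blast
  define y where "y = transpose_mat Q *\<^sub>v x"
  have y: "y \<in> carrier_vec n" using Q x by (simp add: y_def)
  have "Q *\<^sub>v y = (Q * transpose_mat Q) *\<^sub>v x"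
    unfolding y_def using Q x by (subst assoc_mult_mat_vec[of _ n n _ n]) auto
  then have x_eq: "x = Q *\<^sub>v y" using x QQ' by simp
  have "y \<bullet> z = x \<bullet> (Q *\<^sub>v z)" if "z \<in> carrier_vec n" for z
    unfolding y_def using transpose_vec_mult_scalar[OF Q that x(1)] .
  note adj = this
  have "x \<bullet> x = y \<bullet> y"
    using adj[OF y] x_eq by simp
  then have xx: "x \<bullet> x = (\<Sum>j<n. (y $ j)\<^sup>2)"
    using y by (simp add: scalar_prod_def power2_eq_square atLeast0LessThan)
  have Dy: "mat_diag n f *\<^sub>v y = transpose_mat Q *\<^sub>v (A *\<^sub>v x)"
  proof -
    have "mat_diag n f *\<^sub>v y = (transpose_mat Q * A) *\<^sub>v (Q *\<^sub>v y)"
      unfolding diag[symmetric] using Q A y by (subst assoc_mult_mat_vec[of _ n n _ n]) auto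
    also have "\<dots> = transpose_mat Q *\<^sub>v (A *\<^sub>v x)"
      unfolding x_eq[symmetric] using Q A x by (subst assoc_mult_mat_vec[of _ n n _ n]) auto
    finally show ?thesis .
  qed
  have "x \<bullet> (A *\<^sub>v x) = x \<bullet> (Q *\<^sub>v (mat_diag n f *\<^sub>v y))"
  proof -
    have "Q *\<^sub>v (transpose_mat Q *\<^sub>v (A *\<^sub>v x)) = (Q * transpose_mat Q) *\<^sub>v (A *\<^sub>v x)"
      using Q A x by (subst assoc_mult_mat_vec[of _ n n _ n]) auto
    then show ?thesis using A x by (simp add: Dy QQ')
  qed
  also have "\<dots> = y \<bullet> (mat_diag n f *\<^sub>v y)"
    using y by (subst adj) (auto intro!: mult_mat_vec_carrier[of _ n n])
  also have "mat_diag n f *\<^sub>v y = vec n (\<lambda>j. f j * y $ j)"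
  proof (rule eq_vecI)
    fix i assume "i < dim_vec (vec n (\<lambda>j. f j * y $ j))"
    then show "(mat_diag n f *\<^sub>v y) $ i = vec n (\<lambda>j. f j * y $ j) $ i"
      using y by (simp add: scalar_prod_def mat_diag_def if_distrib[of "\<lambda>a. a * _"] cong: if_cong)
  qed (simp add: mat_diag_def)
  also have "y \<bullet> \<dots> = (\<Sum>j<n. f j * (y $ j)\<^sup>2)"
    by (auto simp: scalar_prod_def power2_eq_square atLeast0LessThan intro!: sum.cong)
  finally have xAx: "x \<bullet> (A *\<^sub>v x) = (\<Sum>j<n. f j * (y $ j)\<^sup>2)" .
  obtain j where j: "j < n" "y $ j \<noteq> 0"
  proof (rule ccontr)
    assume "\<not> thesis"
    then have "y = 0\<^sub>v n" using that y by (intro eq_vecI) auto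
    then have "x = 0\<^sub>v n" using x_eq Q by (auto intro!: eq_vecI)
    then show False using x(2) by simp
  qed
  have "(\<Sum>j<n. f j * (y $ j)\<^sup>2) < (\<Sum>j<n. c * (y $ j)\<^sup>2)"
  proof (rule sum_strict_mono_ex1)
    show "\<forall>j\<in>{..<n}. f j * (y $ j)\<^sup>2 \<le> c * (y $ j)\<^sup>2"
    proof
      fix j assume "j \<in> {..<n}"
      then show "f j * (y $ j)\<^sup>2 \<le> c * (y $ j)\<^sup>2"
        using x(4)[of j, folded y_def] less[of j]
        by (cases "j \<in> T") (auto intro!: mult_right_mono)
    qed
    have "f j < c" using j x(4)[of j, folded y_def] less by blast
    then show "\<exists>j\<in>{..<n}. f j * (y $ j)\<^sup>2 < c * (y $ j)\<^sup>2"
      using j by (intro bexI[of _ j] mult_strict_right_mono) auto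
  qed simp
  also have "\<dots> = c * (x \<bullet> x)" by (simp add: xx sum_distrib_left)
  also have "\<dots> \<le> x \<bullet> (A *\<^sub>v x)" by (rule form[OF x(1,3)])
  finally show False using xAx by simp
qed

section \<open>Diagonal dominance on coordinate subspaces\<close>

text \<open>Write \<open>w\<^sub>i = d\<^sub>i x\<^sub>i\<^sup>2\<close>. By the inequality of the arithmetic and geometric means, an
  off-diagonal term is at least \<open>- (w\<^sub>i + w\<^sub>j) / (2 m)\<close>. Summed over all pairs, these losses contain
  each \<open>w\<^sub>i\<close> with the factor \<open>card I / m \<le> 1\<close>, and the diagonal term supplies \<open>w\<^sub>i\<close> once.\<close>

lemma weighted_diagonal_dominance:
  fixes a :: "'i \<Rightarrow> 'i \<Rightarrow> real" and x d :: "'i \<Rightarrow> real"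
  assumes "finite I" and m: "0 < m" "real (card I) \<le> m"
    and d: "\<And>i. i \<in> I \<Longrightarrow> 0 \<le> d i"
    and diag: "\<And>i. i \<in> I \<Longrightarrow> a i i = c + d i"
    and off: "\<And>i j. i \<in> I \<Longrightarrow> j \<in> I \<Longrightarrow> i \<noteq> j \<Longrightarrow> (m * a i j)\<^sup>2 \<le> d i * d j"
  shows "c * (\<Sum>i\<in>I. (x i)\<^sup>2) \<le> (\<Sum>i\<in>I. \<Sum>j\<in>I. a i j * x i * x j)"
proof -
  define w where "w i = d i * (x i)\<^sup>2" for i
  have w: "0 \<le> w i" if "i \<in> I" for i
    using d[OF that] by (simp add: w_def)
  have entry: "(if i = j then (c + d i) * (x i)\<^sup>2 else 0) - (w i + w j) / (2 * m)
      \<le> a i j * x i * x j" if ij: "i \<in> I" "j \<in> I" for i j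
  proof (cases "i = j")
    case True
    then show ?thesis
      using w[OF ij(1)] m diag[OF ij(1)] by (simp add: power2_eq_square)
  next
    case False
    define t where "t = m * (a i j * x i * x j)"
    have "t\<^sup>2 = (m * a i j)\<^sup>2 * ((x i)\<^sup>2 * (x j)\<^sup>2)"
      by (simp add: t_def power_mult_distrib)
    also have "\<dots> \<le> d i * d j * ((x i)\<^sup>2 * (x j)\<^sup>2)"
      using off[OF ij False] by (intro mult_right_mono) auto
    also have "\<dots> = w i * w j" by (simp add: w_def)
    also have "\<dots> \<le> ((w i + w j) / 2)\<^sup>2"
    proof -
      have "((w i + w j) / 2)\<^sup>2 - w i * w j = ((w i - w j) / 2)\<^sup>2"
        by (simp add: power2_eq_square field_simps)
      then show ?thesis by (metis diff_ge_0_iff_ge zero_le_power2)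
    qed
    finally have "\<bar>t\<bar>\<^sup>2 \<le> ((w i + w j) / 2)\<^sup>2" by simp
    then have "\<bar>t\<bar> \<le> (w i + w j) / 2"
      by (rule power2_le_imp_le) (use w ij in auto)
    then have "- ((w i + w j) / 2) \<le> m * (a i j * x i * x j)"
      unfolding t_def by linarith
    then have "- ((w i + w j) / 2 / m) \<le> a i j * x i * x j"
      using m by (subst minus_divide_left, subst pos_divide_le_eq) (auto simp: mult.commute)
    then show ?thesis
      using False by (simp add: mult.commute)
  qed
  have "(\<Sum>i\<in>I. \<Sum>j\<in>I. w i + w j) = 2 * (real (card I) * (\<Sum>i\<in>I. w i))"
    by (simp add: sum.distrib sum_distrib_left)
  then have "(\<Sum>i\<in>I. \<Sum>j\<in>I. (w i + w j) / (2 * m)) = real (card I) / m * (\<Sum>i\<in>I. w i)"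
    by (simp add: sum_divide_distrib[symmetric])
  also have "\<dots> \<le> 1 * (\<Sum>i\<in>I. w i)"
    using m w by (intro mult_right_mono sum_nonneg) (auto simp: divide_simps)
  finally have "c * (\<Sum>i\<in>I. (x i)\<^sup>2) \<le> (\<Sum>i\<in>I. (c + d i) * (x i)\<^sup>2)
      - (\<Sum>i\<in>I. \<Sum>j\<in>I. (w i + w j) / (2 * m))"
    by (simp add: w_def sum_distrib_left distrib_right sum.distrib)
  also have "\<dots> = (\<Sum>i\<in>I. \<Sum>j\<in>I. (if i = j then (c + d i) * (x i)\<^sup>2 else 0)
      - (w i + w j) / (2 * m))"
    using \<open>finite I\<close> by (simp add: sum_subtractf)
  also have "\<dots> \<le> (\<Sum>i\<in>I. \<Sum>j\<in>I. a i j * x i * x j)"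
    using entry by (intro sum_mono) auto
  finally show ?thesis .
qed

text \<open>Rationalizing the denominator turns the quotient into \<open>(s - \<delta>) / 2\<close> with \<open>s\<close> the square
  root, after which the bound can be squared.\<close>

lemma L_entry_le_iff:
  assumes "0 \<le> \<epsilon>"
  shows "L_entry A i j \<le> \<epsilon> \<longleftrightarrow> (A $$ (i, j))\<^sup>2 \<le> \<epsilon> * (\<epsilon> + \<bar>A $$ (i, i) - A $$ (j, j)\<bar>)"
proof -
  define \<delta> b where "\<delta> = \<bar>A $$ (i, i) - A $$ (j, j)\<bar>" and "b = (A $$ (i, j))\<^sup>2"
  have \<delta>: "0 \<le> \<delta>" and b: "0 \<le> b" by (simp_all add: \<delta>_def b_def)
  define s where "s = sqrt (\<delta>\<^sup>2 + 4 * b)"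
  have s: "0 \<le> s" "s\<^sup>2 = \<delta>\<^sup>2 + 4 * b" using b by (simp_all add: s_def)
  have "2 * b / (\<delta> + s) = (s - \<delta>) / 2"
  proof (cases "\<delta> + s = 0")
    case False
    then show ?thesis using s by (simp add: field_simps power2_eq_square)
  qed (use \<delta> s in auto)
  then have "L_entry A i j = (s - \<delta>) / 2"
    by (simp add: L_entry_def \<delta>_def b_def s_def)
  then have "L_entry A i j \<le> \<epsilon> \<longleftrightarrow> s \<le> \<delta> + 2 * \<epsilon>" by auto
  also have "\<dots> \<longleftrightarrow> s\<^sup>2 \<le> (\<delta> + 2 * \<epsilon>)\<^sup>2"
    using s(1) \<delta> assms by (simp add: abs_le_square_iff[symmetric])
  also have "\<dots> \<longleftrightarrow> b \<le> \<epsilon> * (\<epsilon> + \<delta>)"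
  proof -
    have "(\<delta> + 2 * \<epsilon>)\<^sup>2 = \<delta>\<^sup>2 + 4 * (\<epsilon> * (\<epsilon> + \<delta>))"
      by (simp add: power2_eq_square algebra_simps)
    then show ?thesis unfolding s(2) by simp
  qed
  finally show ?thesis by (simp add: \<delta>_def b_def)
qed

text \<open>Dominance holds with weights \<open>d\<^sub>i = p\<^sub>i + n\<^sup>2 \<epsilon>\<close>, where \<open>p\<^sub>i \<ge> 0\<close> is the excess of the
  \<open>i\<close>-th diagonal entry over the \<open>k\<close>-th: the gap of two diagonal entries is at most
  \<open>p\<^sub>i + p\<^sub>j\<close>, and \<open>n\<^sup>2 \<epsilon> (p\<^sub>i + p\<^sub>j)\<close> is the mixed part of \<open>d\<^sub>i d\<^sub>j\<close>.\<close>

lemma form_ge_on_coordinate_subspace: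
  fixes A :: "real mat"
  assumes A: "A \<in> carrier_mat n n" and \<epsilon>: "0 \<le> \<epsilon>" and k: "k < n" and I: "I \<subseteq> {..<n}"
    and diag: "\<And>i. i \<in> I \<Longrightarrow> A $$ (k, k) \<le> A $$ (i, i)"
    and off: "\<And>i j. i < n \<Longrightarrow> j < n \<Longrightarrow> i \<noteq> j \<Longrightarrow>
           (A $$ (i, j))\<^sup>2 \<le> \<epsilon> * (\<epsilon> + \<bar>A $$ (i, i) - A $$ (j, j)\<bar>)"
    and x: "x \<in> carrier_vec n" "\<And>r. r \<in> {..<n} - I \<Longrightarrow> x $ r = 0"
  shows "(A $$ (k, k) - (real n)\<^sup>2 * \<epsilon>) * (x \<bullet> x) \<le> x \<bullet> (A *\<^sub>v x)"
proof -
  define N c where "N = (real n)\<^sup>2" and "c = A $$ (k, k) - N * \<epsilon>"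
  have N: "1 \<le> N" using k by (simp add: N_def)
  have "finite I" using I finite_subset by blast
  moreover have "real (card I) \<le> real n"
    using card_mono[OF _ I] by simp
  moreover have "0 \<le> A $$ (i, i) - c" if "i \<in> I" for i
    using diag[OF that] mult_nonneg_nonneg[OF order_trans[OF zero_le_one N] \<epsilon>] by (simp add: c_def)
  moreover have "(real n * A $$ (i, j))\<^sup>2 \<le> (A $$ (i, i) - c) * (A $$ (j, j) - c)"
    if ij: "i \<in> I" "j \<in> I" "i \<noteq> j" for i j
  proof -
    define p q where "p = A $$ (i, i) - A $$ (k, k)" and "q = A $$ (j, j) - A $$ (k, k)"
    have pq: "0 \<le> p" "0 \<le> q" using diag ij by (simp_all add: p_def q_def)
    have "(real n * A $$ (i, j))\<^sup>2 = N * (A $$ (i, j))\<^sup>2"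
      by (simp add: N_def power_mult_distrib)
    also have "\<dots> \<le> N * (\<epsilon> * (\<epsilon> + \<bar>p - q\<bar>))"
      using off[of i j] ij I N by (intro mult_left_mono) (auto simp: p_def q_def)
    also have "\<dots> \<le> N * (\<epsilon> * (N * \<epsilon> + (p + q)))"
      using pq N \<epsilon> mult_right_mono[OF N \<epsilon>] by (intro mult_left_mono add_mono) auto
    also have "\<dots> \<le> (p + N * \<epsilon>) * (q + N * \<epsilon>)"
      using mult_nonneg_nonneg[OF pq] by (simp add: algebra_simps)
    finally show ?thesis by (simp add: p_def q_def c_def algebra_simps)
  qed
  ultimately have "c * (\<Sum>i\<in>I. (x $ i)\<^sup>2) \<le> (\<Sum>i\<in>I. \<Sum>j\<in>I. A $$ (i, j) * x $ i * x $ j)"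
    using k by (intro weighted_diagonal_dominance[where m = "real n" and d = "\<lambda>i. A $$ (i, i) - c"]) auto
  also have "(\<Sum>i\<in>I. (x $ i)\<^sup>2) = (\<Sum>i<n. (x $ i)\<^sup>2)"
    using I x(2) by (intro sum.mono_neutral_left) auto
  also have "\<dots> = x \<bullet> x"
    using x(1) by (simp add: scalar_prod_def power2_eq_square atLeast0LessThan)
  also have "(\<Sum>i\<in>I. \<Sum>j\<in>I. A $$ (i, j) * x $ i * x $ j) =
      (\<Sum>i\<in>I. \<Sum>j<n. A $$ (i, j) * x $ i * x $ j)"
    using I x(2) by (intro sum.cong sum.mono_neutral_left) auto
  also have "\<dots> = (\<Sum>i<n. \<Sum>j<n. A $$ (i, j) * x $ i * x $ j)"
    using I x(2) by (intro sum.mono_neutral_left) auto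
  also have "\<dots> = x \<bullet> (A *\<^sub>v x)"
    using x(1) A
    by (auto simp: scalar_prod_def atLeast0LessThan sum_distrib_left algebra_simps intro!: sum.cong)
  finally show ?thesis by (simp add: c_def N_def)
qed

section \<open>Eigenvalues close to diagonal entries\<close>

theorem ordered_eigenvalue_near_diagonal:
  fixes A :: "real mat"
  assumes A: "A \<in> carrier_mat n n" and sym: "transpose_mat A = A" and \<epsilon>: "0 \<le> \<epsilon>"
    and mono: "\<And>i j. i \<le> j \<Longrightarrow> j < n \<Longrightarrow> A $$ (j, j) \<le> A $$ (i, i)"
    and off: "\<And>i j. i < n \<Longrightarrow> j < n \<Longrightarrow> i \<noteq> j \<Longrightarrow>
           (A $$ (i, j))\<^sup>2 \<le> \<epsilon> * (\<epsilon> + \<bar>A $$ (i, i) - A $$ (j, j)\<bar>)"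
    and k: "k < n"
  shows "\<bar>ordered_eigenvalue A k - A $$ (k, k)\<bar> \<le> (real n)\<^sup>2 * \<epsilon>"
proof -
  define es where "es = rev (sorted_list_of_multiset (eigenvalue_mset A))"
  note es = ordered_eigenvalues_factorize_char_poly[OF A sym, folded es_def]
  obtain Q where Q: "Q \<in> carrier_mat n n" and QQ: "transpose_mat Q * Q = 1\<^sub>m n"
    and diag: "transpose_mat Q * A * Q = mat_diag n (\<lambda>i. es ! i)"
    using symmetric_orthogonally_diagonalizable[OF A sym es(1)] by blast
  \<comment> \<open>The free coordinates \<open>0, ..., k\<close> are one more than the \<open>k\<close> excluded eigenvectors.\<close>
  have "\<exists>j<n. j \<notin> {..<k} \<and> A $$ (k, k) - (real n)\<^sup>2 * \<epsilon> \<le> es ! j"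
  proof (rule eigenvalue_ge_of_form_ge[OF A Q QQ diag k, where S = "{..<n} - {..k}"])
    show "(A $$ (k, k) - (real n)\<^sup>2 * \<epsilon>) * (x \<bullet> x) \<le> x \<bullet> (A *\<^sub>v x)"
      if "x \<in> carrier_vec n" "\<And>r. r \<in> {..<n} - {..k} \<Longrightarrow> x $ r = 0" for x
      using that k mono off by (intro form_ge_on_coordinate_subspace[OF A \<epsilon> k, of "{..k}"]) auto
  qed (use k in auto)
  then have lower: "A $$ (k, k) - (real n)\<^sup>2 * \<epsilon> \<le> es ! k"
    using es(3)[of k] by (auto simp: not_less intro: order_trans)
  have mA: "- A \<in> carrier_mat n n" using A by simp
  have mdiag: "transpose_mat Q * (- A) * Q = mat_diag n (\<lambda>i. - es ! i)"
  proof -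
    have "transpose_mat Q * (- A) * Q = - (transpose_mat Q * A * Q)"
      using Q A by simp
    then show ?thesis unfolding diag by (auto simp: mat_diag_def)
  qed
  \<comment> \<open>For the negative, coordinates \<open>k, ..., n - 1\<close> are free, one more than the excluded
    eigenvectors after \<open>k\<close>.\<close>
  have "\<exists>j<n. j \<notin> {k<..<n} \<and> (- A) $$ (k, k) - (real n)\<^sup>2 * \<epsilon> \<le> - es ! j"
  proof (rule eigenvalue_ge_of_form_ge[OF mA Q QQ mdiag k, where S = "{..<n} - {k..<n}"])
    show "((- A) $$ (k, k) - (real n)\<^sup>2 * \<epsilon>) * (x \<bullet> x) \<le> x \<bullet> ((- A) *\<^sub>v x)"
      if "x \<in> carrier_vec n" "\<And>r. r \<in> {..<n} - {k..<n} \<Longrightarrow> x $ r = 0" for x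
    proof (rule form_ge_on_coordinate_subspace[OF mA \<epsilon> k, of "{k..<n}"])
      show "((- A) $$ (i, j))\<^sup>2 \<le> \<epsilon> * (\<epsilon> + \<bar>(- A) $$ (i, i) - (- A) $$ (j, j)\<bar>)"
        if "i < n" "j < n" "i \<noteq> j" for i j
        using off[OF that] A that by (simp add: abs_minus_commute)
    qed (use that A k mono in auto)
  qed (use k in auto)
  then have upper: "es ! k \<le> A $$ (k, k) + (real n)\<^sup>2 * \<epsilon>"
    using es(3)[OF _ k] A k by (fastforce simp: not_less)
  have "ordered_eigenvalue A k = es ! k"
    by (simp add: ordered_eigenvalue_def es_def)
  then show ?thesis using lower upper by linarith
qed

theorem theorem1:
  fixes A :: "real mat" and n :: nat and \<epsilon> :: real
  assumes "A \<in> carrier_mat n n"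
    and "symmetric_mat A"
    and "\<And>i j. i \<le> j \<Longrightarrow> j < n \<Longrightarrow> A $$ (i, i) \<ge> A $$ (j, j)"
    and "\<And>i j. i < n \<Longrightarrow> j < n \<Longrightarrow> i \<noteq> j \<Longrightarrow> L_entry A i j \<le> \<epsilon>"
  shows "\<forall>k<n. \<bar>ordered_eigenvalue A k - A $$ (k, k)\<bar> \<le> 2 * real n * (real n - 1) * \<epsilon>"
proof (intro allI impI)
  fix k assume k: "k < n"
  have sym: "transpose_mat A = A" using assms(2) by (simp add: symmetric_mat_def)
  show "\<bar>ordered_eigenvalue A k - A $$ (k, k)\<bar> \<le> 2 * real n * (real n - 1) * \<epsilon>"
  proof (cases "n = 1")
    case True
    \<comment> \<open>There are no off-diagonal entries, so \<open>\<epsilon>\<close> may be negative; the estimate is applied with 0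
      in its place.\<close>
    then have "\<bar>ordered_eigenvalue A k - A $$ (k, k)\<bar> \<le> (real n)\<^sup>2 * 0"
      using assms k by (intro ordered_eigenvalue_near_diagonal[OF assms(1) sym]) auto
    then show ?thesis using True by simp
  next
    case False
    then have n: "2 \<le> n" using k by simp
    have "0 \<le> L_entry A 0 1" by (simp add: L_entry_def)
    also have "\<dots> \<le> \<epsilon>" using assms(4)[of 0 1] n by simp
    finally have \<epsilon>: "0 \<le> \<epsilon>" .
    have "\<bar>ordered_eigenvalue A k - A $$ (k, k)\<bar> \<le> (real n)\<^sup>2 * \<epsilon>"
      using assms k \<epsilon> L_entry_le_iff[OF \<epsilon>]
      by (intro ordered_eigenvalue_near_diagonal[OF assms(1) sym]) auto
    also have "(real n)\<^sup>2 \<le> 2 * real n * (real n - 1)"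
      using n by (simp add: power2_eq_square algebra_simps)
    then have "(real n)\<^sup>2 * \<epsilon> \<le> 2 * real n * (real n - 1) * \<epsilon>"
      using \<epsilon> by (intro mult_right_mono) auto
    finally show ?thesis .
  qed
qed

end
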